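(* For every non-principal ideal $\mathfrak a\subset A_{\infty_1}$, $j(\mathfrak a)\neq j((1))$, where $(1)=A_{\infty_1}$.
   Context: Let $q$ be a prime power, $k=\mathbb F_q(T)$, $A=\mathbb F_q[T]$, $k_\infty=\mathbb F_q((1/T))$ with $|x|=q^{\deg_T x}$. Let $f\in k_\infty\setminus k$ be a root of $X^2-aX-b$ with $a\in A$ monic, $d=\deg_T a\ge1$, $b\in\mathbb F_q^*$, $|f|=q^d$. Let $K=k(f)\subset k_\infty$, $\infty_1$ the place of $K$ induced by this embedding, and $A_{\infty_1}=\mathbb F_q[f,fT,\dots,fT^{d-1}]$ the ring of elements of $K$ regular away from $\infty_1$. An element of $A_{\infty_1}$ is monic if it can be written $c_0+c_1(T)f+\dots+c_k(T)f^k$ with $c_0\in\mathbb F_q$, $c_i\in A$ of degree $\le d-1$ for $i\ge1$, and $c_k$ monic (for $k=0$: the element $1$). For a nonzero ideal $\mathfrak a\subset A_{\infty_1}$, $\zeta^{\mathfrak a}(n(q-1))=\sum_{0\ne x\in\mathfrak a\text{ monic}}x^{n(1-q)}$, $J(\mathfrak a)=\frac{T^{q^2}-T}{(T^q-T)^{q+1}}\cdot\frac{\zeta^{\mathfrak a}(q^2-1)}{\zeta^{\mathfrak a}(q-1)^{q+1}}$, $j(\mathfrak a)=\big(\frac1{T^q-T}-J(\mathfrak a)\big)^{-1}$; $j(\mathfrak a)$ depends only on the ideal class of $\mathfrak a$. *)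

theory Defs
  imports "HOL-Analysis.Infinite_Sum" "HOL-Computational_Algebra.Formal_Laurent_Series"
    "HOL-Computational_Algebra.Polynomial"
begin

text \<open>Model: F_q is a finite field type 'a (q = card (UNIV :: 'a set)).  The completion
  k_infinity = F_q((1/T)) is the type 'a fls of formal Laurent series in the
  uniformizer u = 1/T, with T = fls_X_inv.  Its topology is the library's
  (valuation) metric on fls, which induces the same topology as the absolute
  value |x| = q^(deg_T x) = q^(- fls_subdegree x).\<close>

definition Tpoly :: "'a::field poly \<Rightarrow> 'a fls" where
  "Tpoly p = poly (map_poly fls_const p) fls_X_inv"

definition kfield :: "'a::field fls set" where
  "kfield = {Tpoly p / Tpoly r | p r. r \<noteq> 0}"

inductive_set Ainf :: "nat \<Rightarrow> 'a::field fls \<Rightarrow> 'a fls set" for d f where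
  const: "fls_const c \<in> Ainf d f"
| gen: "i < d \<Longrightarrow> f * fls_X_inv ^ i \<in> Ainf d f"
| add: "x \<in> Ainf d f \<Longrightarrow> y \<in> Ainf d f \<Longrightarrow> x + y \<in> Ainf d f"
| mult: "x \<in> Ainf d f \<Longrightarrow> y \<in> Ainf d f \<Longrightarrow> x * y \<in> Ainf d f"

definition monic_Ainf :: "nat \<Rightarrow> 'a::field fls \<Rightarrow> 'a fls \<Rightarrow> bool" where
  "monic_Ainf d f x \<longleftrightarrow> x \<in> Ainf d f \<and>
     (x = 1 \<or>
      (\<exists>(k::nat) (c0::'a) (c::nat \<Rightarrow> 'a poly).
          k \<ge> 1 \<and> (\<forall>i\<in>{1..k}. degree (c i) \<le> d - 1) \<and> lead_coeff (c k) = 1 \<and>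
          x = fls_const c0 + (\<Sum>i=1..k. Tpoly (c i) * f ^ i)))"

definition nonzero_ideal :: "nat \<Rightarrow> 'a::field fls \<Rightarrow> 'a fls set \<Rightarrow> bool" where
  "nonzero_ideal d f I \<longleftrightarrow> I \<subseteq> Ainf d f \<and> 0 \<in> I \<and> (\<exists>x\<in>I. x \<noteq> 0) \<and>
     (\<forall>x\<in>I. \<forall>y\<in>I. x + y \<in> I) \<and> (\<forall>x\<in>I. - x \<in> I) \<and>
     (\<forall>r\<in>Ainf d f. \<forall>x\<in>I. r * x \<in> I)"

definition principal_ideal :: "nat \<Rightarrow> 'a::field fls \<Rightarrow> 'a fls set \<Rightarrow> bool" where
  "principal_ideal d f I \<longleftrightarrow> (\<exists>g\<in>Ainf d f. I = {g * r | r. r \<in> Ainf d f})"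

text \<open>zeta^I(n(q-1)) = sum over nonzero monic x in I of x^(n(1-q)),
  an (unconditional) infinite sum in k_infinity.\<close>
definition zeta_id :: "nat \<Rightarrow> 'a::{field,finite} fls \<Rightarrow> 'a fls set \<Rightarrow> nat \<Rightarrow> 'a fls" where
  "zeta_id d f I n =
     infsum (\<lambda>x. inverse x ^ (n * (card (UNIV :: 'a set) - 1))) {x \<in> I. x \<noteq> 0 \<and> monic_Ainf d f x}"

definition J_inv :: "nat \<Rightarrow> 'a::{field,finite} fls \<Rightarrow> 'a fls set \<Rightarrow> 'a fls" where
  "J_inv d f I =
     (let q = card (UNIV :: 'a set); T = (fls_X_inv :: 'a fls) in
       (T ^ (q^2) - T) / (T ^ q - T) ^ (q + 1) *
       (zeta_id d f I (q + 1) / zeta_id d f I 1 ^ (q + 1)))"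

definition j_inv :: "nat \<Rightarrow> 'a::{field,finite} fls \<Rightarrow> 'a fls set \<Rightarrow> 'a fls" where
  "j_inv d f I =
     (let q = card (UNIV :: 'a set); T = (fls_X_inv :: 'a fls) in
       inverse (1 / (T ^ q - T) - J_inv d f I))"

end

theory Submission
  imports Defs
begin

text \<open>Divide the ideal by a nonzero element \<open>x\<^sub>0\<close> of minimal degree: this gives a lattice \<open>L\<close> with
  \<open>1 \<in> L\<close> and \<open>A \<subseteq> L\<close>, and it does not change the ratio \<open>\<zeta>(q\<^sup>2-1) / \<zeta>(q-1)^(q+1)\<close>. Let \<open>D\<close> be
  the smallest positive degree in \<open>L\<close>. Summing \<open>x^(1-q)\<close> over translates of \<open>F\<^sub>q\<close> shows that
  \<open>\<zeta>(q-1) = 1 + z\<close> with \<open>z\<close> of valuation exactly \<open>q(q-1)D\<close>, whereas \<open>\<zeta>(q\<^sup>2-1) - 1\<close> has valuation at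
  least \<open>(q\<^sup>2-1)D\<close>. Hence the ratio minus \<open>1\<close> has valuation exactly \<open>q(q-1)D\<close>, and it determines
  \<open>D\<close>. The degrees in \<open>A\<close> are \<open>0\<close> and all \<open>e \<ge> d\<close>, so \<open>D = d\<close> for \<open>L = A\<close>, while \<open>D = d\<close> forces
  \<open>L = A\<close>, i.e. the ideal is principal.\<close>

unbundle fps_syntax

subsection \<open>Valuations and sums of Laurent series\<close>

text \<open>Valuation at least \<open>n\<close>, stated by coefficients so that 0 satisfies it for
  every \<open>n\<close> although \<open>fls_subdegree 0 = 0\<close>.\<close>

definition fls_ge :: "int \<Rightarrow> 'a::zero fls \<Rightarrow> bool" where
  "fls_ge n x \<longleftrightarrow> (\<forall>k<n. x $$ k = 0)"

lemma fls_ge_iff: "fls_ge n x \<longleftrightarrow> x = 0 \<or> n \<le> fls_subdegree x"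
  unfolding fls_ge_def by (auto intro: fls_subdegree_geI)

lemma fls_ge_0 [simp]: "fls_ge n 0"
  by (simp add: fls_ge_iff)

lemma fls_ge_const [simp]: "fls_ge 0 (fls_const c)"
  by (simp add: fls_ge_iff)

lemma fls_ge_1 [simp]: "fls_ge 0 (1 :: 'a::zero_neq_one fls)"
  by (simp add: fls_ge_iff)

lemma fls_ge_mono: "fls_ge n x \<Longrightarrow> m \<le> n \<Longrightarrow> fls_ge m x"
  by (auto simp: fls_ge_def)

lemma fls_ge_add: "fls_ge n x \<Longrightarrow> fls_ge n y \<Longrightarrow> fls_ge n (x + y)"
  for x :: "'a::monoid_add fls"
  by (auto simp: fls_ge_def)

lemma fls_ge_diff: "fls_ge n x \<Longrightarrow> fls_ge n y \<Longrightarrow> fls_ge n (x - y)"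
  for x :: "'a::group_add fls"
  by (auto simp: fls_ge_def)

lemma fls_ge_sum: "(\<And>i. i \<in> A \<Longrightarrow> fls_ge n (g i)) \<Longrightarrow> fls_ge n (sum g A)"
  for g :: "'b \<Rightarrow> 'a::comm_monoid_add fls"
  by (induction A rule: infinite_finite_induct) (auto intro: fls_ge_add)

lemma fls_ge_mult: "fls_ge m x \<Longrightarrow> fls_ge n y \<Longrightarrow> fls_ge (m + n) (x * y)"
  for x :: "'a::semiring_no_zero_divisors fls"
  by (cases "x = 0 \<or> y = 0") (auto simp: fls_ge_iff)

lemma fls_ge_power: "fls_ge m x \<Longrightarrow> fls_ge (int n * m) (x ^ n)"
  for x :: "'a::semiring_1_no_zero_divisors fls"
  by (cases "n = 0") (auto simp: fls_ge_iff fls_subdegree_pow mult_left_mono)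

lemma fls_subdegree_add_ge:
  fixes x :: "'a::group_add fls"
  assumes "x \<noteq> 0" "fls_ge (fls_subdegree x + 1) y"
  shows "x + y \<noteq> 0" "fls_subdegree (x + y) = fls_subdegree x"
    "(x + y) $$ fls_subdegree x = x $$ fls_subdegree x"
proof -
  show eq: "(x + y) $$ fls_subdegree x = x $$ fls_subdegree x"
    using assms(2) by (simp add: fls_ge_def)
  then show "x + y \<noteq> 0"
    using assms(1) by (metis nth_fls_subdegree_nonzero fls_zero_nth)
  show "fls_subdegree (x + y) = fls_subdegree x"
    using assms eq by (intro fls_subdegree_eqI) (auto simp: fls_ge_def)
qed

lemma fls_ge_diff_lead:
  fixes x :: "'a::group_add fls"
  assumes "fls_subdegree x = fls_subdegree y" "x $$ fls_subdegree x = y $$ fls_subdegree y"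
  shows "fls_ge (fls_subdegree x + 1) (x - y)"
  unfolding fls_ge_def
proof safe
  fix k assume "k < fls_subdegree x + 1"
  then consider "k = fls_subdegree x" | "k < fls_subdegree x" by linarith
  then show "(x - y) $$ k = 0" using assms by cases auto
qed

lemma dist_fls_le_iff: "dist x y \<le> inverse (2 ^ n) \<longleftrightarrow> fls_ge (int n) (x - y)"
  for x :: "'a::group_add fls"
proof (cases "x = y \<or> fls_subdegree (x - y) \<ge> 0")
  case True
  then show ?thesis
    by (auto simp: dist_fls_def fls_ge_iff le_nat_iff)
next
  case False
  \<comment> \<open>Negative valuation puts the distance above 1, while the radius is at most 1, so
    both sides fail.\<close>
  have "inverse (2 ^ n) \<le> (1::real)"
    by (simp add: inverse_le_1_iff)
  also have "1 < (2::real) ^ nat (- fls_subdegree (x - y))"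
    using False by (intro one_less_power) auto
  finally show ?thesis using False by (auto simp: dist_fls_def fls_ge_iff)
qed

text \<open>Small balls around 0 are the sets \<open>fls_ge n\<close>, so convergence means
  agreement of coefficients to every order.\<close>

lemma fls_has_sum_iff:
  fixes g :: "'b \<Rightarrow> 'a::ab_group_add fls"
  shows "(g has_sum s) M \<longleftrightarrow>
    (\<forall>n. eventually (\<lambda>G. fls_ge n (sum g G - s)) (finite_subsets_at_top M))"
  unfolding has_sum_def tendsto_iff
proof safe
  fix n
  assume "\<forall>e>0. eventually (\<lambda>G. dist (sum g G) s < e) (finite_subsets_at_top M)"
  then have "eventually (\<lambda>G. dist (sum g G) s < inverse (2 ^ nat n)) (finite_subsets_at_top M)"
    by simp
  then show "eventually (\<lambda>G. fls_ge n (sum g G - s)) (finite_subsets_at_top M)"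
  proof (rule eventually_mono)
    fix G assume "dist (sum g G) s < inverse (2 ^ nat n)"
    then have "fls_ge (int (nat n)) (sum g G - s)"
      unfolding dist_fls_le_iff[symmetric] by simp
    then show "fls_ge n (sum g G - s)" by (rule fls_ge_mono) simp
  qed
next
  fix e :: real
  assume ev: "\<forall>n. eventually (\<lambda>G. fls_ge n (sum g G - s)) (finite_subsets_at_top M)"
  assume "e > 0"
  then obtain n where n: "(1/2) ^ n < e"
    using real_arch_pow_inv[of e "1/2"] by auto
  from ev have "eventually (\<lambda>G. fls_ge (int n) (sum g G - s)) (finite_subsets_at_top M)" ..
  then show "eventually (\<lambda>G. dist (sum g G) s < e) (finite_subsets_at_top M)"
  proof (rule eventually_mono)
    fix G assume "fls_ge (int n) (sum g G - s)"
    then have "dist (sum g G) s \<le> inverse (2 ^ n)" by (simp add: dist_fls_le_iff)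
    also have "\<dots> < e" using n by (simp add: power_one_over inverse_eq_divide)
    finally show "dist (sum g G) s < e" .
  qed
qed

lemma fls_has_sum_cmult:
  fixes g :: "'b \<Rightarrow> 'a::field fls"
  assumes "(g has_sum s) M"
  shows "((\<lambda>x. c * g x) has_sum c * s) M"
  unfolding fls_has_sum_iff
proof
  fix n
  have "eventually (\<lambda>G. fls_ge (n - fls_subdegree c) (sum g G - s)) (finite_subsets_at_top M)"
    using assms unfolding fls_has_sum_iff ..
  then show "eventually (\<lambda>G. fls_ge n ((\<Sum>x\<in>G. c * g x) - c * s)) (finite_subsets_at_top M)"
  proof (rule eventually_mono)
    fix G assume "fls_ge (n - fls_subdegree c) (sum g G - s)"
    then have "fls_ge (fls_subdegree c + (n - fls_subdegree c)) (c * (sum g G - s))"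
      by (intro fls_ge_mult) (auto simp: fls_ge_iff)
    then show "fls_ge n ((\<Sum>x\<in>G. c * g x) - c * s)"
      by (simp add: right_diff_distrib sum_distrib_left)
  qed
qed

text \<open>In an ultrametric setting terms tending to 0 suffice: each coefficient of the sum
  receives only finitely many contributions.\<close>

lemma fls_summable:
  fixes g :: "'b \<Rightarrow> 'a::ab_group_add fls"
  assumes fin: "\<And>n. finite {x \<in> M. \<not> fls_ge n (g x)}" and ge0: "\<And>x. x \<in> M \<Longrightarrow> fls_ge 0 (g x)"
  shows "g summable_on M"
proof -
  define B where "B n = {x \<in> M. \<not> fls_ge n (g x)}" for n
  \<comment> \<open>\<open>B (n + 1)\<close> contains every index whose term has a nonzero
    coefficient at \<open>n\<close>; \<open>ge0\<close> leaves no negative exponents.\<close>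
  define s where "s = fps_to_fls (Abs_fps (\<lambda>n. \<Sum>x\<in>B (int n + 1). g x $$ int n))"
  have "(g has_sum s) M"
    unfolding fls_has_sum_iff
  proof
    fix n
    have "fls_ge n (sum g G - s)" if G: "finite G" "B n \<subseteq> G" "G \<subseteq> M" for G
      unfolding fls_ge_def
    proof safe
      fix k assume k: "k < n"
      have nth_sum: "sum g G $$ k = (\<Sum>x\<in>G. g x $$ k)"
        by (induction G rule: infinite_finite_induct) auto
      show "(sum g G - s) $$ k = 0"
      proof (cases "k < 0")
        case True
        then have "(\<Sum>x\<in>G. g x $$ k) = 0"
          using G ge0 by (intro sum.neutral) (auto simp: fls_ge_def)
        then show ?thesis using True nth_sum by (simp add: s_def)
      next
        case False
        have "B (k + 1) \<subseteq> B n"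
          using k by (auto simp: B_def intro: fls_ge_mono)
        then have "(\<Sum>x\<in>G. g x $$ k) = (\<Sum>x\<in>B (k + 1). g x $$ k)"
          using G by (intro sum.mono_neutral_right) (auto simp: B_def fls_ge_def)
        also have "\<dots> = s $$ k" using False by (simp add: s_def)
        finally show ?thesis using nth_sum by simp
      qed
    qed
    moreover have "finite (B n)" "B n \<subseteq> M" using fin by (auto simp: B_def)
    ultimately show "eventually (\<lambda>G. fls_ge n (sum g G - s)) (finite_subsets_at_top M)"
      unfolding eventually_finite_subsets_at_top by (intro exI[of _ "B n"]) simp
  qed
  then show ?thesis by (auto simp: summable_on_def)
qed

subsection \<open>Power sums over translates of the constants\<close>

text \<open>Translation by 1 permutes the field, so \<open>q\<close> copies of 1 add nothing to the
  sum of all elements.\<close>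

lemma of_nat_card_UNIV: "of_nat (card (UNIV :: 'a set)) = (0 :: 'a::{ring_1,finite})"
proof -
  have "(\<Sum>c\<in>UNIV. c + 1) = (\<Sum>c\<in>UNIV. c :: 'a)"
    by (rule sum.reindex_bij_witness[of _ "\<lambda>c. c - 1" "\<lambda>c. c + 1"]) auto
  then show ?thesis by (simp add: sum.distrib)
qed

lemma card_field_ge_2: "card (UNIV :: 'a::{field,finite} set) \<ge> 2"
  using card_mono[of "UNIV :: 'a set" "{0, 1}"] by simp

text \<open>Multiplication by a nonzero \<open>c\<close> permutes the nonzero elements; cancelling
  their product gives \<open>c ^ (q - 1) = 1\<close>.\<close>

lemma power_card_UNIV:
  fixes c :: "'a::{field,finite}"
  shows "c ^ card (UNIV :: 'a set) = c"
proof (cases "c = 0")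
  case True
  then show ?thesis using card_field_ge_2[where 'a = 'a] by simp
next
  case False
  have "(\<Prod>y\<in>UNIV - {0}. c * y) = (\<Prod>y\<in>UNIV - {0}. y)"
    by (rule prod.reindex_bij_witness[of _ "\<lambda>y. y / c" "\<lambda>y. c * y"]) (use False in auto)
  then have "c ^ (card (UNIV :: 'a set) - 1) = 1"
    by (simp add: prod.distrib)
  then show ?thesis
    using power_minus_mult[of "card (UNIV :: 'a set)" c] card_field_ge_2[where 'a = 'a] by simp
qed

definition artin_schreier :: "'a::{field,finite} fls \<Rightarrow> 'a fls" where
  "artin_schreier y = y ^ card (UNIV :: 'a set) - y"

text \<open>Both sides are monic of degree \<open>q\<close> and vanish at the \<open>q\<close>
  constants, which forces equality.\<close>

lemma artin_schreier_poly:
  "(\<Prod>c\<in>(UNIV::'a::{field,finite} set). [:- fls_const c, 1:]) = monom 1 (card (UNIV::'a set)) - monom 1 1"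
  (is "?P = ?Q")
proof (rule poly_eqI_degree_lead_coeff[where n = "card (UNIV::'a set)" and A = "range fls_const"])
  let ?q = "card (UNIV::'a set)"
  have q: "?q \<ge> 2" by (rule card_field_ge_2)
  have deg: "degree ?P = ?q" by (subst degree_prod_eq_sum_degree) auto
  have "lead_coeff ?P = 1" by (simp add: lead_coeff_prod)
  with deg show "coeff ?P ?q = coeff ?Q ?q" using q by simp
  show "degree ?P \<le> ?q" using deg by simp
  show "degree ?Q \<le> ?q" using q by (intro degree_diff_le) (auto simp: degree_monom_eq)
  show "?q \<le> card (range (fls_const :: 'a \<Rightarrow> _))"
    by (subst card_image) (auto intro!: injI dest: arg_cong[of _ _ "\<lambda>x. x $$ 0"])
  fix z :: "'a fls" assume "z \<in> range fls_const"
  then obtain c where c: "z = fls_const c" by auto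
  have "poly ?P z = 0" by (auto simp: poly_prod c)
  moreover have "poly ?Q z = 0"
    by (simp add: poly_monom c power_card_UNIV flip: fls_const_power)
  ultimately show "poly ?P z = poly ?Q z" by simp
qed

lemma prod_diff_const: "(\<Prod>c\<in>UNIV. y - fls_const c) = artin_schreier y"
  for y :: "'a::{field,finite} fls"
  using arg_cong[OF artin_schreier_poly, of "\<lambda>p. poly p y"]
  by (simp add: poly_prod poly_monom artin_schreier_def)

lemma artin_schreier_add_const: "artin_schreier (y + fls_const c) = artin_schreier y"
proof -
  have "(\<Prod>e\<in>UNIV. y + fls_const c - fls_const e) = (\<Prod>e\<in>UNIV. y - fls_const e)"
    by (rule prod.reindex_bij_witness[of _ "\<lambda>e. e + c" "\<lambda>e. e - c"])
       (auto simp: fls_minus_const[symmetric] fls_plus_const[symmetric])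
  then show ?thesis by (simp add: prod_diff_const)
qed

text \<open>Logarithmic derivative of \<open>X^q - X\<close>.\<close>
lemma sum_inverse_add_const:
  fixes y :: "'a::{field,finite} fls"
  assumes "artin_schreier y \<noteq> 0"
  shows "(\<Sum>c\<in>UNIV. inverse (y + fls_const c)) = - inverse (artin_schreier y)"
proof -
  have nz: "y - fls_const c \<noteq> 0" for c
    using assms prod_diff_const[of y] by (metis UNIV_I finite prod_zero)
  have of_nat0: "of_nat (card (UNIV :: 'a set)) = (0 :: 'a fls)"
    by (simp add: fls_of_nat of_nat_card_UNIV)
  \<comment> \<open>Since \<open>q = 0\<close> in the field, the derivative of
    \<open>X^q - X\<close> is the constant -1.\<close>
  have "poly (pderiv (monom 1 (card (UNIV::'a set)) - monom 1 1)) y = -1"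
    by (simp add: pderiv_diff pderiv_monom poly_monom of_nat0)
  moreover have "poly (pderiv (\<Prod>c\<in>(UNIV::'a set). [:- fls_const c, 1:])) y
      = (\<Sum>c\<in>UNIV. \<Prod>e\<in>UNIV - {c}. y - fls_const e)"
    by (simp add: pderiv_prod poly_sum poly_prod pderiv_pCons)
  moreover have "(\<Prod>e\<in>UNIV - {c}. y - fls_const e) = artin_schreier y * inverse (y - fls_const c)" for c
    using nz[of c] prod.remove[of UNIV c "\<lambda>e. y - fls_const e"]
    by (simp add: prod_diff_const field_simps)
  ultimately have "artin_schreier y * (\<Sum>c\<in>UNIV. inverse (y - fls_const c)) = - 1"
    using artin_schreier_poly[where 'a = 'a] by (simp add: sum_distrib_left)
  moreover have "(\<Sum>c\<in>UNIV. inverse (y - fls_const c)) = (\<Sum>c\<in>UNIV. inverse (y + fls_const c))"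
    by (rule sum.reindex_bij_witness[of _ uminus uminus]) auto
  ultimately show ?thesis
    using assms by (simp add: field_simps)
qed

lemma artin_schreier_subdegree:
  fixes y :: "'a::{field,finite} fls"
  assumes "fls_subdegree y < 0"
  shows "artin_schreier y \<noteq> 0"
    "fls_subdegree (artin_schreier y) = int (card (UNIV :: 'a set)) * fls_subdegree y"
proof -
  let ?q = "card (UNIV :: 'a set)"
  have nz: "y ^ ?q \<noteq> 0" using assms by auto
  have "2 * fls_subdegree y \<ge> int ?q * fls_subdegree y"
    using card_field_ge_2[where 'a = 'a] assms by (intro mult_right_mono_neg) auto
  then have "fls_ge (fls_subdegree (y ^ ?q) + 1) (- y)"
    using assms unfolding fls_ge_iff fls_subdegree_pow fls_uminus_subdegree by linarith
  from fls_subdegree_add_ge[OF nz this]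
  show "artin_schreier y \<noteq> 0" "fls_subdegree (artin_schreier y) = int ?q * fls_subdegree y"
    by (simp_all add: artin_schreier_def fls_subdegree_pow)
qed

text \<open>With \<open>t = y^q - y\<close>, which is invariant under \<open>y \<mapsto> y + c\<close>, one has
  \<open>(y + c)^(1-q) = (y + c) / (y + c + t) = 1 - t / (y + t + c)\<close>, and the ones sum to \<open>q = 0\<close>.\<close>
lemma sum_block:
  fixes y :: "'a::{field,finite} fls"
  assumes y: "fls_subdegree y < 0"
  defines "q \<equiv> card (UNIV :: 'a set)"
  shows "(\<Sum>c\<in>UNIV. inverse (y + fls_const c) ^ (q - 1)) =
      artin_schreier y / artin_schreier (y ^ q)"
proof -
  let ?t = "artin_schreier y"
  have q2: "q \<ge> 2" unfolding q_def by (rule card_field_ge_2)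
  have yq: "fls_subdegree (y ^ q) < 0"
    using y q2 by (simp add: fls_subdegree_pow mult_pos_neg)
  have nz: "z + fls_const c \<noteq> 0" if "fls_subdegree z < 0" for z :: "'a fls" and c
    using that by (metis add_eq_0_iff2 fls_const_subdegree fls_uminus_subdegree less_irrefl)
  have yt: "y + ?t = y ^ q" by (simp add: artin_schreier_def q_def)
  have blk: "inverse (y + fls_const c) ^ (q - 1) = 1 - ?t * inverse (y ^ q + fls_const c)" for c
  proof -
    have "(y + fls_const c) ^ q = y + fls_const c + ?t"
      using artin_schreier_add_const[of y c] by (simp add: artin_schreier_def q_def algebra_simps)
    then have 1: "(y + fls_const c) * (y + fls_const c) ^ (q - 1) = y ^ q + fls_const c"
      using yt q2 by (simp add: algebra_simps flip: power_Suc)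
    have "inverse (y + fls_const c) ^ (q - 1) = (y + fls_const c) * inverse (y ^ q + fls_const c)"
      unfolding 1[symmetric] using nz[OF y, of c] by (simp add: power_inverse)
    also have "\<dots> = (y ^ q + fls_const c - ?t) * inverse (y ^ q + fls_const c)"
      by (simp flip: yt)
    finally show ?thesis
      using nz[OF yq, of c] by (simp add: left_diff_distrib)
  qed
  have "(\<Sum>c\<in>UNIV. inverse (y + fls_const c) ^ (q - 1)) =
      of_nat q - ?t * (\<Sum>c\<in>UNIV. inverse (y ^ q + fls_const c))"
    unfolding blk by (simp add: sum_subtractf sum_distrib_left q_def)
  also have "\<dots> = ?t / artin_schreier (y ^ q)"
    using artin_schreier_subdegree(1)[OF yq]
    by (simp add: sum_inverse_add_const fls_of_nat of_nat_card_UNIV q_def divide_inverse)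
  finally show ?thesis .
qed

text \<open>A single summand only has valuation \<open>(q - 1) e\<close>, where \<open>e\<close> is
  the degree of \<open>y\<close>; cancellation within the block raises it to
  \<open>q^2 e - q e\<close>.\<close>

lemma sum_block_subdegree:
  fixes y :: "'a::{field,finite} fls"
  assumes y: "fls_subdegree y < 0"
  defines "q \<equiv> card (UNIV :: 'a set)"
  defines "s \<equiv> (\<Sum>c\<in>UNIV. inverse (y + fls_const c) ^ (q - 1))"
  shows "s \<noteq> 0" "fls_subdegree s = - int (q * (q - 1)) * fls_subdegree y"
proof -
  have q2: "q \<ge> 2" unfolding q_def by (rule card_field_ge_2)
  have yq: "fls_subdegree (y ^ q) < 0"
    using y q2 by (simp add: fls_subdegree_pow mult_pos_neg)
  have s: "s = artin_schreier y / artin_schreier (y ^ q)"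
    unfolding s_def q_def by (rule sum_block[OF y])
  show "s \<noteq> 0" using artin_schreier_subdegree(1)[OF y] artin_schreier_subdegree(1)[OF yq] s by simp
  then show "fls_subdegree s = - int (q * (q - 1)) * fls_subdegree y"
    using s artin_schreier_subdegree[OF y] artin_schreier_subdegree[OF yq] q2
    by (simp add: divide_inverse fls_subdegree_pow of_nat_diff algebra_simps flip: q_def)
qed

subsection \<open>Zeta values of a lattice\<close>

lemma fls_subdegree_const_mult: "c \<noteq> 0 \<Longrightarrow> fls_subdegree (fls_const c * x) = fls_subdegree x"
  for x :: "'a::field fls"
  by (cases "x = 0") auto

lemma fls_normalize_lead:
  fixes x :: "'a::field fls"
  assumes "x \<noteq> 0"
  shows "fls_subdegree (fls_const (inverse (x $$ fls_subdegree x)) * x) = fls_subdegree x"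
    "(fls_const (inverse (x $$ fls_subdegree x)) * x) $$ fls_subdegree x = 1"
  using assms by (simp_all add: fls_subdegree_const_mult)

text \<open>Common frame for the ring and for an ideal divided by an element of minimal degree.
  \<open>gap\<close> gives discreteness as well as the lower bound on positive degrees; 0 satisfies
  it through the convention \<open>fls_subdegree 0 = 0\<close>.\<close>

locale fls_lattice =
  fixes L :: "'a::{field,finite} fls set" and D :: nat
  assumes one: "1 \<in> L"
    and add: "x \<in> L \<Longrightarrow> y \<in> L \<Longrightarrow> x + y \<in> L"
    and scale: "x \<in> L \<Longrightarrow> fls_const c * x \<in> L"
    and gap: "x \<in> L \<Longrightarrow> fls_subdegree x = 0 \<or> fls_subdegree x \<le> - int D"
    and attained: "\<exists>x\<in>L. fls_subdegree x = - int D"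
    and D_pos: "D > 0"
begin

lemma const: "fls_const c \<in> L"
  using scale[OF one, of c] by simp

lemma diff: "x \<in> L \<Longrightarrow> y \<in> L \<Longrightarrow> x - y \<in> L"
  using add[of x "fls_const (-1) * y"] scale[of y "-1"] by simp

lemma eq_0_if_ge_1: "x \<in> L \<Longrightarrow> fls_ge 1 x \<Longrightarrow> x = 0"
  using gap[of x] by (auto simp: fls_ge_iff)

lemma eq_const:
  assumes "x \<in> L" "fls_subdegree x > - int D"
  shows "x = fls_const (x $$ 0)"
proof -
  have "fls_subdegree x = 0" using gap[OF assms(1)] assms(2) by auto
  then have "fls_ge 1 (x - fls_const (x $$ 0))" by (auto simp: fls_ge_def)
  with eq_0_if_ge_1[OF diff[OF assms(1) const]] show ?thesis by simp
qed

text \<open>Differences of distinct elements never have positive valuation, so an element is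
  determined by its coefficients at the exponents \<open>- N..0\<close>, and a finite field leaves
  finitely many choices.\<close>

lemma finite_bounded: "finite {x \<in> L. - int N \<le> fls_subdegree x}"
proof (rule finite_imageD)
  let ?h = "\<lambda>x :: 'a fls. restrict (\<lambda>k. x $$ k) {- int N..0}"
  show "finite (?h ` {x \<in> L. - int N \<le> fls_subdegree x})"
    by (rule finite_subset[of _ "PiE {- int N..0} (\<lambda>_. UNIV)"]) (auto intro!: finite_PiE)
  show "inj_on ?h {x \<in> L. - int N \<le> fls_subdegree x}"
  proof (rule inj_onI, clarify)
    fix x y
    assume x: "x \<in> L" "- int N \<le> fls_subdegree x" and y: "y \<in> L" "- int N \<le> fls_subdegree y"
      and eq: "?h x = ?h y"
    have "x $$ k = y $$ k" if "k \<le> 0" for k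
      using fun_cong[OF eq, of k] x y that by (cases "k < - int N") auto
    then have "fls_ge 1 (x - y)" by (auto simp: fls_ge_def)
    with eq_0_if_ge_1[OF diff[OF x(1) y(1)]] show "x = y" by simp
  qed
qed

definition mon :: "'a fls set" where
  "mon = {x \<in> L. x $$ fls_subdegree x = 1}"

definition Z :: "nat \<Rightarrow> 'a fls" where
  "Z m = infsum (\<lambda>x. inverse x ^ m) mon"

lemma mon_eq_1:
  assumes "x \<in> mon" "fls_subdegree x > - int D"
  shows "x = 1"
proof -
  have "fls_subdegree x = 0" using assms gap[of x] by (auto simp: mon_def)
  then show ?thesis
    using eq_const[of x] assms by (auto simp: mon_def)
qed

lemma one_in_mon: "1 \<in> mon"
  by (simp add: mon_def one)

lemma mon_subdegree_le: "x \<in> mon \<Longrightarrow> x \<noteq> 1 \<Longrightarrow> fls_subdegree x \<le> - int D"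
  using mon_eq_1[of x] by force

lemma inverse_power_ge:
  fixes x :: "'a fls"
  assumes "fls_subdegree x \<le> - int d"
  shows "fls_ge (int (m * d)) (inverse x ^ m)"
proof -
  have "fls_ge (int d) (inverse x)" using assms by (simp add: fls_ge_iff)
  from fls_ge_power[OF this, of m] show ?thesis by simp
qed

lemma has_sum_Z:
  assumes "m > 0"
  shows "((\<lambda>x. inverse x ^ m) has_sum Z m) mon"
  unfolding Z_def
proof (rule has_sum_infsum, rule fls_summable)
  fix x assume "x \<in> mon"
  then show "fls_ge 0 (inverse x ^ m)"
    using inverse_power_ge[of x 0 m] gap[of x] by (auto simp: mon_def)
next
  fix n
  have "fls_ge n (inverse x ^ m)" if "\<not> - int (nat n) \<le> fls_subdegree x" for x :: "'a fls"
  proof (rule fls_ge_mono)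
    show "fls_ge (int (m * nat n)) (inverse x ^ m)"
      using that by (intro inverse_power_ge) simp
    have "nat n \<le> m * nat n" using assms by simp
    then show "n \<le> int (m * nat n)" by linarith
  qed
  then have "{x \<in> mon. \<not> fls_ge n (inverse x ^ m)} \<subseteq> {x \<in> L. - int (nat n) \<le> fls_subdegree x}"
    unfolding mon_def by blast
  then show "finite {x \<in> mon. \<not> fls_ge n (inverse x ^ m)}"
    using finite_bounded by (rule finite_subset)
qed

lemma Z_approx:
  assumes "m > 0"
  obtains F where "finite F" "F \<subseteq> mon"
    "\<And>G. finite G \<Longrightarrow> F \<subseteq> G \<Longrightarrow> G \<subseteq> mon \<Longrightarrow> fls_ge n ((\<Sum>x\<in>G. inverse x ^ m) - Z m)"
proof -
  have "eventually (\<lambda>G. fls_ge n ((\<Sum>x\<in>G. inverse x ^ m) - Z m)) (finite_subsets_at_top mon)"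
    using has_sum_Z[OF assms] unfolding fls_has_sum_iff ..
  then show ?thesis
    unfolding eventually_finite_subsets_at_top using that by auto
qed

text \<open>The element 1 contributes the only term of valuation below \<open>m * D\<close>, and
  this bound passes to the limit.\<close>

lemma Z_minus_1_ge:
  assumes "m > 0"
  shows "fls_ge (int (m * D)) (Z m - 1)"
proof -
  obtain F where F: "finite F" "F \<subseteq> mon"
    and ge: "\<And>G. finite G \<Longrightarrow> F \<subseteq> G \<Longrightarrow> G \<subseteq> mon \<Longrightarrow>
      fls_ge (int (m * D)) ((\<Sum>x\<in>G. inverse x ^ m) - Z m)"
    using Z_approx[OF assms] by blast
  define G where "G = insert 1 F"
  have G: "finite G" "F \<subseteq> G" "G \<subseteq> mon" "1 \<in> G"
    using F one_in_mon by (auto simp: G_def)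
  have "fls_ge (int (m * D)) (\<Sum>x\<in>G - {1}. inverse x ^ m)"
    using G mon_subdegree_le by (intro fls_ge_sum inverse_power_ge) auto
  then have "fls_ge (int (m * D)) ((\<Sum>x\<in>G - {1}. inverse x ^ m) - ((\<Sum>x\<in>G. inverse x ^ m) - Z m))"
    using ge[OF G(1-3)] by (rule fls_ge_diff)
  then show ?thesis
    using G(1,4) by (simp add: sum.remove algebra_simps)
qed

text \<open>One representative, with zero constant coefficient, for each orbit of nonconstant monic
  elements under translation by constants; \<open>N\<close> bounds the degree to keep the set
  finite.\<close>

definition blocks :: "nat \<Rightarrow> 'a fls set" where
  "blocks N = {x \<in> mon. x \<noteq> 1 \<and> - int N \<le> fls_subdegree x \<and> x $$ 0 = 0}"

text \<open>Translation by a constant alters neither degree nor leading coefficient of a nonconstant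
  monic element, so a truncation by degree is a union of full orbits; coefficient 0 recovers the
  translation.\<close>

lemma sum_over_blocks:
  "(\<Sum>x | x \<in> mon \<and> x \<noteq> 1 \<and> - int N \<le> fls_subdegree x. g x) =
   (\<Sum>y\<in>blocks N. \<Sum>c\<in>UNIV. g (y + fls_const c))"
proof -
  have shift: "y + fls_const c \<in> mon \<and> y + fls_const c \<noteq> 1 \<and>
      fls_subdegree (y + fls_const c) = fls_subdegree y" if "y \<in> mon" "y \<noteq> 1" for y c
  proof -
    have y: "fls_subdegree y < 0" using mon_subdegree_le[OF that] D_pos by simp
    then have "y \<noteq> 0" "fls_ge (fls_subdegree y + 1) (fls_const c)"
      by (auto simp: fls_ge_iff)
    from fls_subdegree_add_ge[OF this] show ?thesis
      using that y add const by (auto simp: mon_def dest: arg_cong[of _ _ fls_subdegree])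
  qed
  have fin: "finite (blocks N)"
    by (rule finite_subset[OF _ finite_bounded[of N]]) (auto simp: blocks_def mon_def)
  have "(\<Sum>x | x \<in> mon \<and> x \<noteq> 1 \<and> - int N \<le> fls_subdegree x. g x) =
      (\<Sum>(y, c)\<in>blocks N \<times> UNIV. g (y + fls_const c))"
  proof (rule sum.reindex_bij_witness[of _ "\<lambda>(y, c). y + fls_const c"
        "\<lambda>x. (x + fls_const (- (x $$ 0)), x $$ 0)"])
    fix x assume "x \<in> {x \<in> mon. x \<noteq> 1 \<and> - int N \<le> fls_subdegree x}"
    then show "(x + fls_const (- (x $$ 0)), x $$ 0) \<in> blocks N \<times> UNIV"
      using shift[of x "- (x $$ 0)"] unfolding blocks_def by auto
  next
    fix p :: "'a fls \<times> 'a" assume "p \<in> blocks N \<times> UNIV"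
    then show "(case p of (y, c) \<Rightarrow> y + fls_const c) \<in> {x \<in> mon. x \<noteq> 1 \<and> - int N \<le> fls_subdegree x}"
      using shift[of "fst p" "snd p"] unfolding blocks_def by auto
  qed (auto simp: blocks_def)
  then show ?thesis by (simp add: sum.cartesian_product)
qed

text \<open>The translates of an element of minimal positive degree form a single block, and the sum over
  a block of degree \<open>e\<close> has valuation exactly \<open>q (q - 1) e\<close>.\<close>
lemma Z_minus_1_subdegree:
  defines "q \<equiv> card (UNIV :: 'a set)"
  shows "Z (q - 1) - 1 \<noteq> 0" "fls_subdegree (Z (q - 1) - 1) = int (q * (q - 1) * D)"
proof -
  have q2: "q \<ge> 2" unfolding q_def by (rule card_field_ge_2)
  \<comment> \<open>One more than the claimed valuation: whatever is \<open>fls_ge n\<close> is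
    negligible.\<close>
  define n where "n = int (q * (q - 1) * D) + 1"
  define s where "s y = (\<Sum>c\<in>UNIV. inverse (y + fls_const c) ^ (q - 1))" for y :: "'a fls"
  obtain x0 where x0: "x0 \<in> L" "fls_subdegree x0 = - int D" using attained by auto
  then have x0_nz: "x0 \<noteq> 0" using D_pos by auto
  \<comment> \<open>An element of degree \<open>D\<close> is made monic and stripped of its constant
    coefficient, giving the representative \<open>y1\<close> of the block of least degree.\<close>
  define y1' where "y1' = fls_const (inverse (x0 $$ fls_subdegree x0)) * x0"
  define y1 where "y1 = y1' + fls_const (- (y1' $$ 0))"
  have y1': "y1' \<in> L" "fls_subdegree y1' = - int D" "y1' $$ fls_subdegree y1' = 1"
    using x0 scale fls_normalize_lead[OF x0_nz, folded y1'_def] by (auto simp: y1'_def)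
  then have "y1' \<noteq> 0" "fls_ge (fls_subdegree y1' + 1) (fls_const (- (y1' $$ 0)))"
    using D_pos by (auto simp: fls_ge_iff)
  note y1_y1' = fls_subdegree_add_ge[OF this, folded y1_def]
  have y1: "y1 \<in> L" "fls_subdegree y1 = - int D" "y1 $$ fls_subdegree y1 = 1" "y1 $$ 0 = 0"
    using y1' y1_y1' diff const by (auto simp: y1_def)
  obtain F where F: "finite F" "F \<subseteq> mon"
    and ge: "\<And>G. finite G \<Longrightarrow> F \<subseteq> G \<Longrightarrow> G \<subseteq> mon \<Longrightarrow>
      fls_ge n ((\<Sum>x\<in>G. inverse x ^ (q - 1)) - Z (q - 1))"
    using Z_approx[of "q - 1" n] q2 by auto
  \<comment> \<open>Large enough for the truncation to include the block of \<open>y1\<close> and,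
    once 1 is adjoined, all of \<open>F\<close>.\<close>
  define N where "N = Max (insert D ((\<lambda>x. nat (- fls_subdegree x)) ` F))"
  have N: "D \<le> N" "\<And>x. x \<in> F \<Longrightarrow> nat (- fls_subdegree x) \<le> N"
    using F(1) by (auto simp: N_def)
  define B where "B = {x \<in> mon. x \<noteq> 1 \<and> - int N \<le> fls_subdegree x}"
  have finB: "finite B"
    by (rule finite_subset[OF _ finite_bounded[of N]]) (auto simp: B_def mon_def)
  have finb: "finite (blocks N)"
    by (rule finite_subset[OF _ finB]) (auto simp: B_def blocks_def)
  have "F \<subseteq> insert 1 B"
    using F(2) N(2) by (force simp: B_def)
  then have 1: "fls_ge n ((\<Sum>x\<in>insert 1 B. inverse x ^ (q - 1)) - Z (q - 1))"
    using finB one_in_mon by (intro ge) (auto simp: B_def)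
  have "1 \<notin> B" by (simp add: B_def)
  then have "(\<Sum>x\<in>insert 1 B. inverse x ^ (q - 1)) = 1 + (\<Sum>y\<in>blocks N. s y)"
    using finB sum_over_blocks[of "\<lambda>x. inverse x ^ (q - 1)" N] by (simp add: s_def B_def)
  moreover have y1_in: "y1 \<in> blocks N"
    using y1 N(1) D_pos by (auto simp: blocks_def mon_def)
  ultimately have 2: "fls_ge n (1 + s y1 + (\<Sum>y\<in>blocks N - {y1}. s y) - Z (q - 1))"
    using 1 finb by (simp add: sum.remove add.assoc)
  have "fls_ge n (s y)" if y: "y \<in> blocks N - {y1}" for y
  proof -
    have yL: "y \<in> L" "y $$ fls_subdegree y = 1" "y $$ 0 = 0" "fls_subdegree y \<le> - int D"
      using y mon_subdegree_le[of y] by (auto simp: blocks_def mon_def)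
    \<comment> \<open>Two monic elements of degree \<open>D\<close> differ by something of smaller
      degree, hence by a constant, which is 0 because both constant coefficients vanish.\<close>
    have "fls_subdegree y \<noteq> - int D"
    proof
      assume deg: "fls_subdegree y = - int D"
      then have "fls_ge (- int D + 1) (y - y1)"
        using fls_ge_diff_lead[of y y1] y1 yL by simp
      then have "fls_subdegree (y - y1) > - int D"
        using D_pos by (auto simp: fls_ge_iff)
      then have "y - y1 = fls_const ((y - y1) $$ 0)"
        by (intro eq_const diff yL y1)
      also have "(y - y1) $$ 0 = 0" using yL y1 by simp
      finally show False using y by simp
    qed
    then have "fls_subdegree y \<le> - int D - 1" using yL by simp
    then have "int (q * (q - 1)) * (int D + 1) \<le> int (q * (q - 1)) * - fls_subdegree y"
      by (intro mult_left_mono) auto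
    moreover have "int (q * (q - 1)) \<ge> 1" using q2 by (simp add: Suc_le_eq flip: of_nat_mult)
    moreover have "fls_subdegree (s y) = int (q * (q - 1)) * - fls_subdegree y"
      using sum_block_subdegree(2)[of y] yL D_pos by (simp add: s_def q_def)
    ultimately show ?thesis
      unfolding fls_ge_iff n_def by (simp add: algebra_simps)
  qed
  then have "fls_ge n (\<Sum>y\<in>blocks N - {y1}. s y)" by (rule fls_ge_sum)
  from fls_ge_diff[OF this 2] have ge_n: "fls_ge n (Z (q - 1) - 1 - s y1)"
    by (simp add: algebra_simps)
  have s1: "s y1 \<noteq> 0" "fls_subdegree (s y1) = int (q * (q - 1) * D)"
    using sum_block_subdegree[of y1] y1 D_pos by (auto simp: s_def q_def)
  have "fls_ge (fls_subdegree (s y1) + 1) (Z (q - 1) - 1 - s y1)"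
    using ge_n s1 by (simp add: n_def)
  from fls_subdegree_add_ge[OF s1(1) this]
  show "Z (q - 1) - 1 \<noteq> 0" "fls_subdegree (Z (q - 1) - 1) = int (q * (q - 1) * D)"
    using s1 by auto
qed

end

section \<open>The ratio of zeta values\<close>

lemma one_plus_power_card:
  fixes z :: "'a::{field,finite} fls"
  assumes "fls_ge n z" "n \<ge> 0"
  shows "fls_ge (2 * n) ((1 + z) ^ (card (UNIV :: 'a set) + 1) - (1 + z))"
proof -
  \<comment> \<open>Binomial expansion with integral remainder \<open>h\<close>; for
    \<open>k = q + 1\<close> the linear coefficient is 1 because \<open>q = 0\<close>.\<close>
  have "\<exists>h. fls_ge 0 h \<and> (1 + z) ^ k = 1 + of_nat k * z + z ^ 2 * h" for k
  proof (induction k)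
    case (Suc k)
    then obtain h where h: "fls_ge 0 h" "(1 + z) ^ k = 1 + of_nat k * z + z ^ 2 * h" by auto
    have z0: "fls_ge 0 z" using assms by (rule fls_ge_mono)
    have "fls_ge 0 (of_nat k + h + z * h)"
      using h(1) fls_ge_mult[OF z0 h(1)] by (intro fls_ge_add) (auto simp: fls_of_nat)
    moreover have "(1 + z) ^ Suc k = 1 + of_nat (Suc k) * z + z ^ 2 * (of_nat k + h + z * h)"
      by (simp add: h(2) algebra_simps power2_eq_square)
    ultimately show ?case by blast
  qed (auto intro!: exI[of _ 0])
  then obtain h where h: "fls_ge 0 h"
    "(1 + z) ^ (card (UNIV :: 'a set) + 1) =
      1 + of_nat (card (UNIV :: 'a set) + 1) * z + z ^ 2 * h" by blast
  have "of_nat (card (UNIV :: 'a set) + 1) = (1 :: 'a fls)"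
    by (simp add: fls_of_nat of_nat_card_UNIV)
  then have "(1 + z) ^ (card (UNIV :: 'a set) + 1) - (1 + z) = z ^ 2 * h"
    using h(2) by simp
  moreover have "fls_ge (2 * n + 0) (z ^ 2 * h)"
    using fls_ge_power[OF assms(1), of 2] h(1) by (intro fls_ge_mult) auto
  ultimately show ?thesis by simp
qed

context fls_lattice
begin

text \<open>Modulo valuation \<open>n + 1\<close> the numerator is 1 and the denominator is
  \<open>1 + z\<close>, so the ratio minus 1 has the leading term of \<open>- z\<close>.\<close>

lemma ratio_subdegree:
  defines "q \<equiv> card (UNIV :: 'a set)"
  shows "fls_subdegree (Z ((q + 1) * (q - 1)) / Z (q - 1) ^ (q + 1) - 1) = int (q * (q - 1) * D)"
proof -
  have q2: "q \<ge> 2" unfolding q_def by (rule card_field_ge_2)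
  define n where "n = int (q * (q - 1) * D)"
  have n_pos: "n > 0" using q2 D_pos by (simp add: n_def)
  define z where "z = Z (q - 1) - 1"
  have z: "z \<noteq> 0" "fls_subdegree z = n"
    using Z_minus_1_subdegree by (auto simp: z_def n_def q_def)
  define w where "w = Z ((q + 1) * (q - 1)) - 1"
  have w0: "fls_ge (int ((q + 1) * (q - 1) * D)) w"
    using Z_minus_1_ge[of "(q + 1) * (q - 1)"] q2 by (simp add: w_def)
  \<comment> \<open>\<open>(q^2 - 1) D\<close> exceeds \<open>q (q - 1) D\<close> by
    \<open>(q - 1) D \<ge> 1\<close>, which makes \<open>w\<close> negligible.\<close>
  have "(q + 1) * (q - 1) * D = q * (q - 1) * D + (q - 1) * D"
    by (simp only: add_mult_distrib mult_1_left)
  moreover have "(q - 1) * D \<ge> 1" using q2 D_pos by (simp add: Suc_le_eq)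
  ultimately have "n + 1 \<le> int ((q + 1) * (q - 1) * D)"
    unfolding n_def by linarith
  with w0 have w: "fls_ge (n + 1) w" by (rule fls_ge_mono)
  define u where "u = (1 + z) ^ (q + 1)"
  have u1: "fls_ge (n + 1) (u - (1 + z))"
    using one_plus_power_card[of n z] z n_pos
    by (auto simp: u_def q_def fls_ge_iff)
  have "fls_ge (fls_subdegree (1 :: 'a fls) + 1) z" using z n_pos by (simp add: fls_ge_iff)
  from fls_subdegree_add_ge[OF _ this] have "1 + z \<noteq> 0" "fls_subdegree (1 + z) = 0"
    by auto
  then have u: "u \<noteq> 0" "fls_subdegree u = 0"
    by (simp_all add: u_def fls_subdegree_pow)
  have Zs: "Z ((q + 1) * (q - 1)) = 1 + w" "Z (q - 1) ^ (q + 1) = u"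
    by (simp_all add: w_def u_def z_def)
  have "fls_ge (n + 1) (w - (u - (1 + z)))" using w u1 by (rule fls_ge_diff)
  then have "fls_ge (fls_subdegree (- z) + 1) (w - (u - (1 + z)))" using z by simp
  from fls_subdegree_add_ge[OF _ this] z have
    "1 + w - u \<noteq> 0" "fls_subdegree (1 + w - u) = n" by (auto simp: algebra_simps)
  moreover have "(1 + w) / u - 1 = (1 + w - u) * inverse u"
    using u by (simp add: field_simps)
  ultimately show ?thesis
    unfolding Zs n_def[symmetric] using u by simp
qed

end

text \<open>Descent on the degree: a scalar multiple of \<open>g\<close> cancels the leading term of
  \<open>x\<close>, and \<open>g \<in> L\<close> keeps the remainder in \<open>L\<close>; below
  degree \<open>D\<close> only constants remain. It serves both to expand ring elements in powers of
  \<open>f\<close> and to show that a lattice lies in the ring.\<close>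

lemma (in fls_lattice) subset_if_degrees_attained:
  assumes V_const: "\<And>c. fls_const c \<in> V"
    and V_add: "\<And>x y. x \<in> V \<Longrightarrow> y \<in> V \<Longrightarrow> x + y \<in> V"
    and V_scale: "\<And>c x. x \<in> V \<Longrightarrow> fls_const c * x \<in> V"
    and V_deg: "\<And>e. e \<ge> D \<Longrightarrow> \<exists>g\<in>V \<inter> L. fls_subdegree g = - int e"
  shows "L \<subseteq> V"
proof
  fix x assume "x \<in> L"
  then show "x \<in> V"
  proof (induction "nat (- fls_subdegree x)" arbitrary: x rule: less_induct)
    case less
    show ?case
    proof (cases "fls_subdegree x > - int D")
      case True
      with less.prems V_const eq_const show ?thesis by metis
    next
      case False
      then have "D \<le> nat (- fls_subdegree x)" by simp
      then obtain g where g: "g \<in> V" "g \<in> L" "fls_subdegree g = fls_subdegree x"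
        using False V_deg[of "nat (- fls_subdegree x)"] by auto
      have nz: "g \<noteq> 0" "x \<noteq> 0" using False g D_pos by auto
      define c where "c = x $$ fls_subdegree x / g $$ fls_subdegree g"
      have c: "c \<noteq> 0" using nz by (simp add: c_def)
      define y where "y = x - fls_const c * g"
      have yL: "y \<in> L" unfolding y_def by (intro diff scale less.prems g)
      have "fls_ge (fls_subdegree x + 1) y"
        unfolding y_def using g nz c
        by (intro fls_ge_diff_lead) (simp_all add: fls_subdegree_const_mult, simp add: c_def)
      \<comment> \<open>For \<open>y = 0\<close> the measure is 0, still smaller because the degree
        of \<open>x\<close> is at least \<open>D > 0\<close>.\<close>
      then have "nat (- fls_subdegree y) < nat (- fls_subdegree x)"
        using False D_pos by (auto simp: fls_ge_iff)
      then have "y + fls_const c * g \<in> V"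
        using less.hyps yL V_add V_scale g by blast
      then show ?thesis by (simp add: y_def)
    qed
  qed
qed

lemma fls_lead_mult:
  fixes x y :: "'a::semiring_no_zero_divisors fls"
  shows "(x * y) $$ fls_subdegree (x * y) = x $$ fls_subdegree x * y $$ fls_subdegree y"
  by (cases "x = 0 \<or> y = 0") (auto simp flip: fls_times_base)

lemma fls_lead_power:
  fixes x :: "'a::semiring_1_no_zero_divisors fls"
  shows "(x ^ n) $$ fls_subdegree (x ^ n) = (x $$ fls_subdegree x) ^ n"
  by (induction n) (simp_all add: fls_lead_mult)

subsection \<open>The ring of elements regular away from the infinite place\<close>

lemma Tpoly_0 [simp]: "Tpoly 0 = 0"
  by (simp add: Tpoly_def)

lemma Tpoly_pCons: "Tpoly (pCons a p) = fls_const a + fls_X_inv * Tpoly p"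
  by (simp add: Tpoly_def map_poly_pCons)

lemma Tpoly_add: "Tpoly (p + r) = Tpoly p + Tpoly r"
  by (induction p r rule: poly_induct2)
     (simp_all add: Tpoly_pCons algebra_simps flip: fls_plus_const)

lemma Tpoly_smult: "Tpoly (smult c p) = fls_const c * Tpoly p"
  by (induction p) (simp_all add: Tpoly_pCons algebra_simps flip: fls_const_mult_const)

lemma Tpoly_mult: "Tpoly (p * r) = Tpoly p * Tpoly r"
  by (induction p) (simp_all add: Tpoly_pCons Tpoly_add Tpoly_smult algebra_simps)

lemma Tpoly_monom: "Tpoly (monom c n) = fls_const c * fls_X_inv ^ n"
  by (induction n) (simp_all add: monom_0 monom_Suc Tpoly_pCons algebra_simps)

lemma Tpoly_nth: "Tpoly p $$ k = (if k \<le> 0 then coeff p (nat (- k)) else 0)"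
proof (induction p arbitrary: k)
  case (pCons a p)
  have nth: "Tpoly (pCons a p) $$ k = (if k = 0 then a else 0) + Tpoly p $$ (k + 1)"
    by (simp add: Tpoly_pCons fls_X_inv_times_conv_shift)
  show ?case
  proof (cases "k < 0")
    case True
    then have "nat (- k) = Suc (nat (- (k + 1)))" by simp
    then show ?thesis using True by (simp add: nth pCons.IH)
  qed (simp add: nth pCons.IH)
qed simp

lemma Tpoly_eq_0_iff [simp]: "Tpoly p = 0 \<longleftrightarrow> p = 0"
proof
  assume "Tpoly p = 0"
  then have "Tpoly p $$ (- int (degree p)) = 0" by simp
  then show "p = 0" by (simp add: Tpoly_nth)
qed simp

lemma Tpoly_subdegree [simp]: "fls_subdegree (Tpoly p) = - int (degree p)"
proof (cases "p = 0")
  case False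
  then show ?thesis
    by (intro fls_subdegree_eqI) (auto simp: Tpoly_nth intro!: coeff_eq_0)
qed simp

lemma Tpoly_lead: "Tpoly p $$ (- int (degree p)) = lead_coeff p"
  by (simp add: Tpoly_nth)

section \<open>The quadratic unit and the degrees occurring in its ring\<close>

locale quadratic_unit =
  fixes a :: "'a::{field,finite} poly" and b :: 'a and f :: "'a fls" and d :: nat
  assumes a_monic: "lead_coeff a = 1"
    and d_def: "d = degree a" and d_pos: "d \<ge> 1"
    and b_nz: "b \<noteq> 0"
    and f_root: "f ^ 2 - Tpoly a * f - fls_const b = 0"
    and f_abs: "fls_subdegree f = - int d"
begin

lemma f_nz: "f \<noteq> 0"
  using f_abs d_pos by auto

definition f' :: "'a fls" where "f' = Tpoly a - f"

lemma f_sq: "f ^ 2 = Tpoly a * f + fls_const b"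
  using f_root by (simp add: algebra_simps)

lemma f'_sq: "f' ^ 2 = Tpoly a * f' + fls_const b"
  using f_sq by (simp add: f'_def algebra_simps power2_eq_square)

lemma f'_nz: "f' \<noteq> 0"
  using f'_sq b_nz by auto

text \<open>The product of the two roots is \<open>- b\<close>, a nonzero constant, so their
  valuations are opposite.\<close>

lemma f'_subdegree: "fls_subdegree f' = int d"
proof -
  have "f * f' = - fls_const b"
    using f_sq by (simp add: f'_def algebra_simps power2_eq_square)
  then have "fls_subdegree (f * f') = 0" by simp
  then show ?thesis using f_nz f'_nz f_abs by simp
qed

text \<open>\<open>f = a - f'\<close> with \<open>f'\<close> of positive valuation, so
  \<open>f\<close> inherits the leading coefficient of the monic \<open>a\<close>.\<close>

lemma f_lead: "f $$ fls_subdegree f = 1"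
proof -
  have "f $$ (- int d) = Tpoly a $$ (- int d) - f' $$ (- int d)" by (simp add: f'_def)
  then show ?thesis using f_abs f'_subdegree d_pos Tpoly_lead[of a] a_monic d_def by simp
qed

text \<open>\<open>u + v f'\<close> is the conjugate of \<open>u + v f\<close>; the generators of the ring have integral
  conjugates at infinity, i.e. they are regular at the second infinite place.\<close>
lemma Ainf_conjugate_integral:
  assumes "x \<in> Ainf d f"
  shows "\<exists>u v. x = Tpoly u + Tpoly v * f \<and> fls_ge 0 (Tpoly u + Tpoly v * f')"
  using assms
proof induction
  case (const c)
  show ?case
    by (intro exI[of _ "[:c:]"] exI[of _ 0]) (simp add: Tpoly_pCons)
next
  case (gen i)
  \<comment> \<open>The conjugate \<open>T^i f'\<close> has valuation \<open>d - i > 0\<close>; this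
    is where \<open>i < d\<close> enters.\<close>
  then show ?case
    using f'_nz f'_subdegree
    by (intro exI[of _ 0] exI[of _ "monom 1 i"]) (simp add: Tpoly_monom fls_ge_iff fls_subdegree_pow)
next
  case (add x y)
  then obtain u1 v1 u2 v2 where
    "x = Tpoly u1 + Tpoly v1 * f" "y = Tpoly u2 + Tpoly v2 * f"
    and ge: "fls_ge 0 (Tpoly u1 + Tpoly v1 * f')" "fls_ge 0 (Tpoly u2 + Tpoly v2 * f')" by blast
  then show ?case
    using fls_ge_add[OF ge]
    by (intro exI[of _ "u1 + u2"] exI[of _ "v1 + v2"]) (simp add: Tpoly_add algebra_simps)
next
  case (mult x y)
  then obtain u1 v1 u2 v2 where
    xy: "x = Tpoly u1 + Tpoly v1 * f" "y = Tpoly u2 + Tpoly v2 * f"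
    and ge: "fls_ge 0 (Tpoly u1 + Tpoly v1 * f')" "fls_ge 0 (Tpoly u2 + Tpoly v2 * f')" by blast
  \<comment> \<open>Reducing the product by the quadratic equation works for either root, so the
    same \<open>u\<close> and \<open>v\<close> serve for the product and its conjugate.\<close>
  define u v where "u = u1 * u2 + smult b (v1 * v2)" and "v = u1 * v2 + u2 * v1 + a * v1 * v2"
  have eq: "(Tpoly u1 + Tpoly v1 * g) * (Tpoly u2 + Tpoly v2 * g) = Tpoly u + Tpoly v * g"
    if "g ^ 2 = Tpoly a * g + fls_const b" for g
  proof -
    have "(Tpoly u1 + Tpoly v1 * g) * (Tpoly u2 + Tpoly v2 * g) =
      Tpoly u1 * Tpoly u2 + (Tpoly u1 * Tpoly v2 + Tpoly u2 * Tpoly v1) * g + Tpoly v1 * Tpoly v2 * g ^ 2"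
      by (simp add: algebra_simps power2_eq_square)
    then show ?thesis
      unfolding that by (simp add: u_def v_def Tpoly_add Tpoly_mult Tpoly_smult algebra_simps)
  qed
  show ?case
    using fls_ge_mult[OF ge] eq[OF f_sq] eq[OF f'_sq] xy
    by (intro exI[of _ u] exI[of _ v]) simp
qed

text \<open>Write \<open>x\<close> as its conjugate plus \<open>v (f - f')\<close>. The conjugate is
  integral, so for \<open>v \<noteq> 0\<close> the second summand dominates and the degree is
  \<open>degree v + d\<close>; for \<open>v = 0\<close> the polynomial \<open>u\<close> is integral,
  hence constant.\<close>

lemma Ainf_gap:
  assumes "x \<in> Ainf d f"
  shows "fls_subdegree x = 0 \<or> fls_subdegree x \<le> - int d"
proof -
  obtain u v where x: "x = Tpoly u + Tpoly v * f" and ge: "fls_ge 0 (Tpoly u + Tpoly v * f')"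
    using Ainf_conjugate_integral[OF assms] by blast
  show ?thesis
  proof (cases "v = 0")
    case True
    then show ?thesis using x ge by (auto simp: fls_ge_iff)
  next
    case False
    have "fls_ge (fls_subdegree f + 1) (- f')"
      using f_abs f'_subdegree d_pos by (simp add: fls_ge_iff)
    from fls_subdegree_add_ge(1,2)[OF f_nz this]
    have ff': "f - f' \<noteq> 0" "fls_subdegree (f - f') = - int d" using f_abs by auto
    then have w: "Tpoly v * (f - f') \<noteq> 0" "fls_subdegree (Tpoly v * (f - f')) = - int (degree v) - int d"
      using False by auto
    then have "fls_ge (fls_subdegree (Tpoly v * (f - f')) + 1) (Tpoly u + Tpoly v * f')"
      using d_pos by (intro fls_ge_mono[OF ge]) auto
    from fls_subdegree_add_ge(2)[OF w(1) this]
    have "fls_subdegree x = - int (degree v) - int d"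
      using w by (simp add: x algebra_simps)
    then show ?thesis by simp
  qed
qed

section \<open>Elements of every large degree and expansions in powers of \<open>f\<close>\<close>

lemma Ainf_power: "f ^ n \<in> Ainf d f"
proof (induction n)
  case 0
  show ?case using Ainf.const[of 1 d f] by simp
next
  case (Suc n)
  then show ?case using Ainf.gen[of 0 d f] d_pos Ainf.mult by fastforce
qed

lemma Ainf_generator: "i < d \<Longrightarrow> fls_X_inv ^ i * f ^ Suc n \<in> Ainf d f"
  using Ainf.mult[OF Ainf.gen[of i d f] Ainf_power[of n]] by (simp add: mult_ac)

lemma degree_decomposition:
  assumes "e \<ge> d"
  obtains i n where "i < d" "fls_subdegree (fls_X_inv ^ i * f ^ Suc n) = - int e"
proof -
  \<comment> \<open>Division with remainder; \<open>e \<ge> d\<close> gives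
    \<open>e div d \<ge> 1\<close>, so the subtraction in \<open>n\<close> is not truncated.\<close>
  define i n where "i = e mod d" and "n = e div d - 1"
  have "i < d" using d_pos by (simp add: i_def)
  have "e div d > 0" using assms d_pos by (simp add: div_greater_zero_iff)
  then have "e = i + Suc n * d" by (simp add: i_def n_def)
  then have "fls_subdegree (fls_X_inv ^ i * f ^ Suc n) = - int e"
    using f_nz f_abs by (simp add: fls_subdegree_pow algebra_simps)
  with \<open>i < d\<close> show ?thesis by (rule that)
qed

lemma Ainf_lattice: "fls_lattice (Ainf d f) d"
proof
  show "1 \<in> Ainf d f" using Ainf.const[of 1 d f] by simp
  show "\<exists>x\<in>Ainf d f. fls_subdegree x = - int d"
    using Ainf_power[of 1] f_abs by auto
qed (use d_pos Ainf_gap in \<open>auto intro: Ainf.intros\<close>)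

text \<open>\<open>c\<close> is a total sequence vanishing beyond \<open>k\<close>, so that
  expansions of different lengths can be added termwise.\<close>

definition expansions :: "'a fls set" where
  "expansions = {x. \<exists>k c0 c. (\<forall>i. degree (c i) \<le> d - 1) \<and> (\<forall>i>k. c i = 0) \<and>
     x = fls_const c0 + (\<Sum>i=1..k. Tpoly (c i) * f ^ i)}"

lemma expansions_add:
  assumes "x \<in> expansions" "y \<in> expansions"
  shows "x + y \<in> expansions"
proof -
  obtain k c0 c where c: "\<forall>i. degree (c i) \<le> d - 1" "\<forall>i>k. c i = 0"
    "x = fls_const c0 + (\<Sum>i=1..k. Tpoly (c i) * f ^ i)"
    using assms(1) unfolding expansions_def by blast
  obtain l e0 e where e: "\<forall>i. degree (e i) \<le> d - 1" "\<forall>i>l. e i = 0"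
    "y = fls_const e0 + (\<Sum>i=1..l. Tpoly (e i) * f ^ i)"
    using assms(2) unfolding expansions_def by blast
  let ?m = "max k l"
  have "(\<Sum>i=1..k. Tpoly (c i) * f ^ i) = (\<Sum>i=1..?m. Tpoly (c i) * f ^ i)"
    using c by (intro sum.mono_neutral_left) auto
  moreover have "(\<Sum>i=1..l. Tpoly (e i) * f ^ i) = (\<Sum>i=1..?m. Tpoly (e i) * f ^ i)"
    using e by (intro sum.mono_neutral_left) auto
  ultimately have "x + y = fls_const (c0 + e0) + (\<Sum>i=1..?m. Tpoly (c i + e i) * f ^ i)"
    using c e by (simp add: Tpoly_add algebra_simps sum.distrib flip: fls_plus_const)
  moreover have "\<forall>i. degree (c i + e i) \<le> d - 1" using c e by (simp add: degree_add_le)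
  moreover have "\<forall>i>?m. c i + e i = 0" using c e by simp
  ultimately show ?thesis unfolding expansions_def
    by (intro CollectI exI[of _ ?m] exI[of _ "c0 + e0"] exI[of _ "\<lambda>i. c i + e i"]) auto
qed

lemma expansions_scale:
  assumes "x \<in> expansions"
  shows "fls_const s * x \<in> expansions"
proof -
  obtain k c0 c where c: "\<forall>i. degree (c i) \<le> d - 1" "\<forall>i>k. c i = 0"
    "x = fls_const c0 + (\<Sum>i=1..k. Tpoly (c i) * f ^ i)"
    using assms(1) unfolding expansions_def by blast
  then have "fls_const s * x = fls_const (s * c0) + (\<Sum>i=1..k. Tpoly (smult s (c i)) * f ^ i)"
    by (simp add: Tpoly_smult algebra_simps sum_distrib_left)
  moreover have "\<forall>i. degree (smult s (c i)) \<le> d - 1"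
    using c by (simp add: degree_smult_eq)
  moreover have "\<forall>i>k. smult s (c i) = 0" using c by simp
  ultimately show ?thesis unfolding expansions_def
    by (intro CollectI exI[of _ k] exI[of _ "s * c0"] exI[of _ "\<lambda>i. smult s (c i)"]) auto
qed

lemma expansions_const: "fls_const c \<in> expansions"
  unfolding expansions_def
  by (intro CollectI exI[of _ 0] exI[of _ c] exI[of _ "\<lambda>_. 0"]) simp

lemma expansions_generator:
  assumes "i < d"
  shows "fls_X_inv ^ i * f ^ Suc n \<in> expansions"
  unfolding expansions_def mem_Collect_eq
proof -
  let ?c = "\<lambda>m. if m = Suc n then monom 1 i else (0 :: 'a poly)"
  have 1: "\<forall>m. degree (?c m) \<le> d - 1"
    using assms by (auto simp: degree_monom_eq)
  have 2: "\<forall>m>Suc n. ?c m = 0" by simp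
  have "(\<Sum>m=1..Suc n. Tpoly (?c m) * f ^ m) =
      (\<Sum>m=1..Suc n. if m = Suc n then Tpoly (monom 1 i) * f ^ m else 0)"
    by (intro sum.cong) auto
  also have "\<dots> = fls_X_inv ^ i * f ^ Suc n"
    by (subst sum.delta) (auto simp: Tpoly_monom)
  finally have sum: "(\<Sum>m=1..Suc n. Tpoly (?c m) * f ^ m) = fls_X_inv ^ i * f ^ Suc n" .
  have "fls_X_inv ^ i * f ^ Suc n = fls_const 0 + (\<Sum>m=1..Suc n. Tpoly (?c m) * f ^ m)"
    unfolding sum by simp
  with 1 2 show "\<exists>k c0 c. (\<forall>i. degree (c i) \<le> d - 1) \<and> (\<forall>i>k. c i = 0) \<and>
      fls_X_inv ^ i * f ^ Suc n = fls_const c0 + (\<Sum>i=1..k. Tpoly (c i) * f ^ i)"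
    by (intro exI conjI)
qed

text \<open>Descent avoids multiplying expansions: it needs only constants, linear closure and an
  element of each degree \<open>e \<ge> d\<close>.\<close>

lemma Ainf_subset_expansions: "Ainf d f \<subseteq> expansions"
proof (rule fls_lattice.subset_if_degrees_attained[OF Ainf_lattice])
  fix e assume "d \<le> e"
  then show "\<exists>g\<in>expansions \<inter> Ainf d f. fls_subdegree g = - int e"
    using degree_decomposition expansions_generator Ainf_generator by (metis IntI)
qed (auto intro: expansions_const expansions_add expansions_scale)

text \<open>A nonzero summand with index \<open>i\<close> has degree between \<open>i d\<close> and
  \<open>(i + 1) d - 1\<close>; these ranges are disjoint, so the top summand dominates.\<close>

lemma expansion_lead:
  fixes c0 :: 'a and c :: "nat \<Rightarrow> 'a poly"
  assumes "k \<ge> 1" "\<forall>i\<in>{1..k}. degree (c i) \<le> d - 1" "c k \<noteq> 0"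
  defines "x \<equiv> fls_const c0 + (\<Sum>i=1..k. Tpoly (c i) * f ^ i)"
  shows "x $$ fls_subdegree x = lead_coeff (c k)"
proof -
  define y where "y = Tpoly (c k) * f ^ k"
  define r where "r = fls_const c0 + (\<Sum>i=1..<k. Tpoly (c i) * f ^ i)"
  have x: "x = y + r"
    using assms(1) by (simp add: x_def y_def r_def sum.last_plus add_ac)
  have y_nz: "y \<noteq> 0" using assms f_nz by (simp add: y_def)
  have y_deg: "fls_subdegree y = - int (degree (c k)) - int (k * d)"
    using assms f_nz f_abs by (simp add: y_def fls_subdegree_pow)
  have "fls_ge (1 - int (k * d)) (Tpoly (c i) * f ^ i)" if i: "i \<in> {1..<k}" for i
  proof -
    have "degree (c i) \<le> d - 1" using assms(2) i by auto
    then have "degree (c i) + i * d + 1 \<le> Suc i * d" using d_pos by simp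
    also have "\<dots> \<le> k * d" using i by (intro mult_right_mono) auto
    finally have "int (degree (c i) + i * d + 1) \<le> int (k * d)" by (rule of_nat_mono)
    then show ?thesis
      using f_nz f_abs by (cases "c i = 0") (simp_all add: fls_ge_iff fls_subdegree_pow)
  qed
  then have "fls_ge (1 - int (k * d)) (\<Sum>i=1..<k. Tpoly (c i) * f ^ i)"
    by (rule fls_ge_sum)
  moreover have "k * d \<ge> 1" using assms(1) d_pos by (simp add: Suc_le_eq)
  then have "1 - int (k * d) \<le> 0" by linarith
  then have "fls_ge (1 - int (k * d)) (fls_const c0)"
    by (rule fls_ge_mono[OF fls_ge_const])
  ultimately have "fls_ge (1 - int (k * d)) r"
    unfolding r_def by (intro fls_ge_add)
  then have "fls_ge (fls_subdegree y + 1) r"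
    by (rule fls_ge_mono) (simp add: y_deg)
  from fls_subdegree_add_ge[OF y_nz this]
  have "x $$ fls_subdegree x = y $$ fls_subdegree y" by (simp add: x)
  also have "\<dots> = lead_coeff (c k)"
    unfolding y_def fls_lead_mult fls_lead_power f_lead by (simp add: Tpoly_lead)
  finally show ?thesis .
qed

text \<open>Leading coefficients are multiplicative, unlike the shape of an expansion, so this form
  survives division by an element of the ideal.\<close>

lemma monic_Ainf_iff: "monic_Ainf d f x \<longleftrightarrow> x \<in> Ainf d f \<and> x $$ fls_subdegree x = 1"
proof (rule iffI, goal_cases)
  case 1
  then have xA: "x \<in> Ainf d f" by (simp add: monic_Ainf_def)
  from 1 consider "x = 1" | k c0 c where "k \<ge> 1" "\<forall>i\<in>{1..k}. degree (c i) \<le> d - 1"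
    "lead_coeff (c k) = 1" "x = fls_const c0 + (\<Sum>i=1..k. Tpoly (c i) * f ^ i)"
    unfolding monic_Ainf_def by blast
  then show ?case
  proof cases
    case 2
    then have "c k \<noteq> 0" by auto
    from expansion_lead[OF 2(1,2) this] 2 show ?thesis using xA by simp
  qed (use xA in simp)
next
  case 2
  then obtain k c0 c where c: "\<forall>i. degree (c i) \<le> d - 1"
    "x = fls_const c0 + (\<Sum>i=1..k. Tpoly (c i) * f ^ i)"
    using Ainf_subset_expansions unfolding expansions_def by blast
  \<comment> \<open>Induction on the length removes vanishing top coefficients; at length 0,
    \<open>x\<close> is a constant with leading coefficient 1.\<close>
  from c(2) show ?case
  proof (induction k)
    case 0
    then have "x = 1" using 2 by auto
    then show ?case using 2 by (simp add: monic_Ainf_def)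
  next
    case (Suc k)
    show ?case
    proof (cases "c (Suc k) = 0")
      case False
      with expansion_lead[of "Suc k" c c0] c(1) Suc.prems 2 have "lead_coeff (c (Suc k)) = 1"
        by simp
      then show ?thesis
        unfolding monic_Ainf_def using 2 Suc.prems c(1)
        by (intro conjI disjI2 exI[of _ "Suc k"] exI[of _ c0] exI[of _ c]) auto
    qed (use Suc in simp)
  qed
qed

section \<open>Comparison of a nonprincipal ideal with the ring\<close>

lemma zeta_id_Ainf:
  "zeta_id d f (Ainf d f) n = fls_lattice.Z (Ainf d f) (n * (card (UNIV :: 'a set) - 1))"
proof -
  interpret A: fls_lattice "Ainf d f" d by (rule Ainf_lattice)
  have "{x \<in> Ainf d f. x \<noteq> 0 \<and> monic_Ainf d f x} = A.mon"
    by (auto simp: A.mon_def monic_Ainf_iff)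
  then show ?thesis by (simp add: zeta_id_def A.Z_def)
qed

lemma J_inv_Ainf_neq:
  assumes I: "nonzero_ideal d f I" and nonprincipal: "\<not> principal_ideal d f I"
  shows "J_inv d f I \<noteq> J_inv d f (Ainf d f)"
proof -
  interpret A: fls_lattice "Ainf d f" d by (rule Ainf_lattice)
  let ?q = "card (UNIV :: 'a set)"
  have q2: "?q \<ge> 2" by (rule card_field_ge_2)
  have I_sub: "I \<subseteq> Ainf d f" and I_add: "\<And>x y. x \<in> I \<Longrightarrow> y \<in> I \<Longrightarrow> x + y \<in> I"
    and I_mult: "\<And>r x. r \<in> Ainf d f \<Longrightarrow> x \<in> I \<Longrightarrow> r * x \<in> I"
    and I_nz: "\<exists>x. x \<in> I \<and> x \<noteq> 0"
    using I by (auto simp: nonzero_ideal_def)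
  obtain x1 where x1: "x1 \<in> I" "x1 \<noteq> 0"
    and x1_min: "\<And>x. x \<in> I \<Longrightarrow> x \<noteq> 0 \<Longrightarrow> nat (- fls_subdegree x1) \<le> nat (- fls_subdegree x)"
    using ex_has_least_nat[of "\<lambda>x. x \<in> I \<and> x \<noteq> 0" _ "\<lambda>x. nat (- fls_subdegree x)"] I_nz by blast
  \<comment> \<open>Normalising makes multiplication by \<open>x0\<close> preserve leading
    coefficients.\<close>
  define x0 where "x0 = fls_const (inverse (x1 $$ fls_subdegree x1)) * x1"
  note x0_deg = fls_normalize_lead[OF x1(2), folded x0_def]
  have x0: "x0 \<in> I" "x0 \<noteq> 0" "x0 $$ fls_subdegree x0 = 1"
    using I_mult[OF Ainf.const x1(1)] x1 x0_deg by (auto simp: x0_def)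
  \<comment> \<open>Ring elements never have positive valuation, so \<open>nat\<close> loses nothing
    in the minimality of \<open>x1\<close>.\<close>
  have x0_min: "fls_subdegree x \<le> fls_subdegree x0" if "x \<in> I" "x \<noteq> 0" for x
  proof -
    have "x \<in> Ainf d f" "x1 \<in> Ainf d f" using that x1 I_sub by auto
    then show ?thesis
      using x1_min[OF that] Ainf_gap[of x] Ainf_gap[of x1] x0_deg(1) by linarith
  qed
  define L where "L = {y. x0 * y \<in> I}"
  have A_sub_L: "Ainf d f \<subseteq> L"
    using I_mult x0 by (auto simp: L_def mult.commute)
  have L_nonpos: "fls_subdegree y \<le> 0" if "y \<in> L" for y
    using x0_min[of "x0 * y"] that x0 by (cases "y = 0") (auto simp: L_def)
  define P where "P e \<longleftrightarrow> e > 0 \<and> (\<exists>y\<in>L. fls_subdegree y = - int e)" for e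
  define D where "D = (LEAST e. P e)"
  \<comment> \<open>The subset \<open>Ainf d f\<close> of \<open>L\<close> supplies degree
    \<open>d\<close>, so a least positive degree exists and is at most \<open>d\<close>.\<close>
  have "P d" using A.attained A_sub_L d_pos by (auto simp: P_def)
  then have "P D" "D \<le> d" unfolding D_def by (auto intro: LeastI Least_le)
  interpret L: fls_lattice L D
  proof
    show "1 \<in> L" using A_sub_L A.one by auto
    show "x + y \<in> L" if "x \<in> L" "y \<in> L" for x y
      using that I_add by (simp add: L_def distrib_left)
    show "fls_const c * x \<in> L" if "x \<in> L" for x c
      using I_mult[OF Ainf.const[of c], of "x0 * x"] that by (simp add: L_def mult.left_commute)
    show "fls_subdegree x = 0 \<or> fls_subdegree x \<le> - int D" if "x \<in> L" for x
    proof (rule disjCI)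
      assume "\<not> fls_subdegree x \<le> - int D"
      then have "nat (- fls_subdegree x) < D" using \<open>P D\<close> by (auto simp: P_def)
      then have "\<not> P (nat (- fls_subdegree x))"
        unfolding D_def by (rule not_less_Least)
      then show "fls_subdegree x = 0"
        using that L_nonpos[OF that] by (auto simp: P_def)
    qed
  qed (use \<open>P D\<close> in \<open>auto simp: P_def\<close>)
  have "D \<noteq> d"
  proof
    assume "D = d"
    \<comment> \<open>The ring has elements of every degree at least \<open>d\<close>, so with
      \<open>D = d\<close> descent puts all of \<open>L\<close> inside it, and then
      \<open>x0\<close> generates \<open>I\<close>.\<close>
    have "L \<subseteq> Ainf d f"
    proof (rule L.subset_if_degrees_attained)
      fix e assume "D \<le> e"
      then show "\<exists>g\<in>Ainf d f \<inter> L. fls_subdegree g = - int e"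
        using degree_decomposition[of e] Ainf_generator A_sub_L \<open>D = d\<close> by (metis IntI subsetD)
    qed (auto intro: Ainf.intros A.scale)
    have "I = {x0 * r | r. r \<in> Ainf d f}"
    proof safe
      fix x assume "x \<in> I"
      then have "x = x0 * (x / x0)" "x / x0 \<in> L" using x0 by (auto simp: L_def)
      then show "\<exists>r. x = x0 * r \<and> r \<in> Ainf d f" using \<open>L \<subseteq> Ainf d f\<close> by blast
    next
      fix r assume "r \<in> Ainf d f"
      then show "x0 * r \<in> I" using I_mult x0 by (simp add: mult.commute)
    qed
    with nonprincipal x0 I_sub show False unfolding principal_ideal_def by blast
  qed
  have mon_eq: "{x \<in> I. x \<noteq> 0 \<and> monic_Ainf d f x} = (*) x0 ` L.mon"
  proof safe
    fix x assume x: "x \<in> I" "x \<noteq> 0" "monic_Ainf d f x"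
    then have "x = x0 * (x / x0)" "x / x0 \<in> L" using x0 by (auto simp: L_def)
    moreover have "(x / x0) $$ fls_subdegree (x / x0) = 1"
      using fls_lead_mult[of x0 "x / x0"] x x0 by (simp add: monic_Ainf_iff)
    ultimately show "x \<in> (*) x0 ` L.mon" unfolding L.mon_def by blast
  next
    fix y assume "y \<in> L.mon"
    then have y: "y \<in> L" "y $$ fls_subdegree y = 1" by (simp_all add: L.mon_def)
    from y(1) show "x0 * y \<in> I" by (simp add: L_def)
    then show "monic_Ainf d f (x0 * y)"
      using fls_lead_mult[of x0 y] x0 y(2) I_sub by (auto simp: monic_Ainf_iff)
    show "x0 * y = 0 \<Longrightarrow> False" using x0(2) y(2) by auto
  qed
  have zeta_I: "zeta_id d f I n = inverse x0 ^ (n * (?q - 1)) * L.Z (n * (?q - 1))"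
    if "n > 0" for n
  proof -
    have m: "n * (?q - 1) > 0" using that q2 by simp
    have inj: "inj_on ((*) x0) L.mon" using x0 by (auto intro: inj_onI)
    have "((\<lambda>y. inverse x0 ^ (n * (?q - 1)) * inverse y ^ (n * (?q - 1)))
        has_sum inverse x0 ^ (n * (?q - 1)) * L.Z (n * (?q - 1))) L.mon"
      by (rule fls_has_sum_cmult[OF L.has_sum_Z[OF m]])
    then show ?thesis
      unfolding zeta_id_def mon_eq infsum_reindex[OF inj]
      by (intro infsumI) (simp add: o_def power_mult_distrib)
  qed
  define RA where "RA = A.Z ((?q + 1) * (?q - 1)) / A.Z (?q - 1) ^ (?q + 1)"
  define RL where "RL = L.Z ((?q + 1) * (?q - 1)) / L.Z (?q - 1) ^ (?q + 1)"
  have "fls_subdegree (RA - 1) \<noteq> fls_subdegree (RL - 1)"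
    unfolding RA_def RL_def A.ratio_subdegree L.ratio_subdegree using \<open>D \<noteq> d\<close> q2 by auto
  then have RA_RL: "RA \<noteq> RL" by auto
  define C where "C = (fls_X_inv ^ (?q\<^sup>2) - fls_X_inv) / (fls_X_inv ^ ?q - fls_X_inv :: 'a fls) ^ (?q + 1)"
  have X_inv: "fls_X_inv ^ m - fls_X_inv \<noteq> (0 :: 'a fls)" if "m \<ge> 2" for m
  proof
    assume "fls_X_inv ^ m - fls_X_inv = (0 :: 'a fls)"
    then have "fls_subdegree (fls_X_inv ^ m :: 'a fls) = fls_subdegree (fls_X_inv :: 'a fls)" by simp
    then show False using that by (simp add: fls_subdegree_pow)
  qed
  have "?q\<^sup>2 \<ge> 2" using q2 power_increasing[of 1 2 ?q] by simp
  then have C: "C \<noteq> 0" using X_inv[OF q2] X_inv[of "?q\<^sup>2"] by (simp add: C_def)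
  have "J_inv d f (Ainf d f) = C * RA"
    by (simp add: J_inv_def Let_def C_def RA_def zeta_id_Ainf)
  moreover have "zeta_id d f I (?q + 1) / zeta_id d f I 1 ^ (?q + 1) = RL"
  proof -
    \<comment> \<open>Numerator and denominator are both homogeneous of weight
      \<open>(q - 1) (q + 1)\<close> in \<open>x0\<close>, so the factor \<open>s\<close>
      cancels.\<close>
    define s where "s = (inverse x0 ^ (?q - 1)) ^ (?q + 1)"
    have "s \<noteq> 0" using x0(2) by (simp add: s_def)
    moreover have "inverse x0 ^ ((?q + 1) * (?q - 1)) = s"
      unfolding s_def by (subst mult.commute) (rule power_mult)
    then have "zeta_id d f I (?q + 1) = s * L.Z ((?q + 1) * (?q - 1))"
      using zeta_I[of "?q + 1"] by simp
    moreover have "zeta_id d f I 1 ^ (?q + 1) = s * L.Z (?q - 1) ^ (?q + 1)"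
      unfolding s_def zeta_I[OF zero_less_one] mult_1 by (rule power_mult_distrib)
    ultimately show ?thesis by (simp only: RL_def mult_divide_mult_cancel_left not_False_eq_True)
  qed
  then have "J_inv d f I = C * RL"
    by (simp only: J_inv_def Let_def C_def)
  ultimately show ?thesis using C RA_RL by simp
qed

end

theorem theorem5:
  fixes a :: "'a::{field,finite} poly" and b :: 'a and f :: "'a fls" and d :: nat
    and I :: "'a fls set"
  assumes a_monic: "lead_coeff a = 1"
    and d_def: "d = degree a" and d_pos: "d \<ge> 1"
    and b_nz: "b \<noteq> 0"
    and f_root: "f ^ 2 - Tpoly a * f - fls_const b = 0"
    and f_notin_k: "f \<notin> kfield"
    and f_abs: "fls_subdegree f = - int d"
    and I_ideal: "nonzero_ideal d f I"
    and I_nonprincipal: "\<not> principal_ideal d f I"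
  shows "j_inv d f I \<noteq> j_inv d f (Ainf d f)"
proof -
  interpret quadratic_unit a b f d
    by unfold_locales (fact a_monic d_def d_pos b_nz f_root f_abs)+
  \<comment> \<open>With \<open>inverse 0 = 0\<close>, inversion is injective on the whole field, so
    \<open>j_inv\<close> determines \<open>J_inv\<close> even where the inverted difference
    vanishes.\<close>
  show ?thesis
    using J_inv_Ainf_neq[OF I_ideal I_nonprincipal] by (simp add: j_inv_def Let_def)
qed

end
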